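(* Let $\mathbb{H}$ be a finite-dimensional Hilbert space over $\mathbb{K}\in\{\mathbb{R},\mathbb{C}\}$ and let $T:\mathbb{H}\to\mathbb{H}$ be a (bounded) linear operator. Then there exists an orthonormal basis $\mathbb{S}=\{x_1,x_2,\ldots,x_n\}$ of $\mathbb{H}$ such that $T$ preserves orthogonality on $\mathbb{S}$, i.e., $\langle Tx_i,Tx_j\rangle=0$ whenever $i\neq j$. *)

theory Defs
  imports "HOL-Analysis.Analysis"
begin

text \<open>
  The library has real inner product spaces (class \<^class>\<open>real_inner\<close>) but no complex ones.
  As the real part of a complex inner product is a real inner product with the same norm, a
  complex inner product space is a \<^class>\<open>real_inner\<close> space with a compatible complex
  structure; norm, metric and topology are inherited.  Positive definiteness of the complex inner
  product is not a separate axiom, as it follows from that of its real part (see below).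
  Convention: linear in the first argument, conjugate-linear in the second.
\<close>

class complex_inner = real_inner +
  fixes scaleC :: "complex \<Rightarrow> 'a \<Rightarrow> 'a"  (infixr "*\<^sub>C" 75)
    and cinner :: "'a \<Rightarrow> 'a \<Rightarrow> complex"
  assumes scaleC_add_right: "c *\<^sub>C (x + y) = c *\<^sub>C x + c *\<^sub>C y"
    and scaleC_add_left: "(c + d) *\<^sub>C x = c *\<^sub>C x + d *\<^sub>C x"
    and scaleC_scaleC: "c *\<^sub>C (d *\<^sub>C x) = (c * d) *\<^sub>C x"
    and scaleC_of_real: "complex_of_real r *\<^sub>C x = r *\<^sub>R x"
    and cinner_commute: "cinner x y = cnj (cinner y x)"
    and cinner_add_left: "cinner (x + y) z = cinner x z + cinner y z"
    and cinner_scaleC_left: "cinner (c *\<^sub>C x) y = c * cinner x y"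
    and Re_cinner: "Re (cinner x y) = inner x y"

lemma vector_space_scaleC: "vector_space ((*\<^sub>C) :: complex \<Rightarrow> 'a \<Rightarrow> 'a::complex_inner)"
proof
  show "1 *\<^sub>C x = x" for x :: 'a
    using scaleC_of_real[of 1 x] by simp
qed (simp_all add: scaleC_add_right scaleC_add_left scaleC_scaleC)

lemma cinner_self: "cinner x x = complex_of_real ((norm x)\<^sup>2)"
proof -
  have "Im (cinner x x) = 0"
    using arg_cong[OF cinner_commute[of x x], of Im] by simp
  then show ?thesis
    by (simp add: complex_eq_iff Re_cinner power2_norm_eq_inner)
qed

lemma cinner_self_eq_0_iff: "cinner x x = 0 \<longleftrightarrow> x = 0"
  by (simp add: cinner_self)

instantiation complex :: complex_inner
begin
definition scaleC_complex :: "complex \<Rightarrow> complex \<Rightarrow> complex"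
  where "scaleC_complex c z = c * z"
definition cinner_complex :: "complex \<Rightarrow> complex \<Rightarrow> complex"
  where "cinner_complex w z = w * cnj z"
instance
  by standard
    (auto simp: scaleC_complex_def cinner_complex_def algebra_simps inner_complex_def
      scaleR_conv_of_real)
end

instantiation vec :: (complex_inner, finite) complex_inner
begin
definition scaleC_vec :: "complex \<Rightarrow> ('a, 'b) vec \<Rightarrow> ('a, 'b) vec"
  where "scaleC_vec c x = (\<chi> i. c *\<^sub>C (x $ i))"
definition cinner_vec :: "('a, 'b) vec \<Rightarrow> ('a, 'b) vec \<Rightarrow> complex"
  where "cinner_vec x y = (\<Sum>i\<in>UNIV. cinner (x $ i) (y $ i))"
instance
proof
  fix x y :: "('a, 'b) vec"
  show "cinner x y = cnj (cinner y x)"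
    unfolding cinner_vec_def cnj_sum by (intro sum.cong refl cinner_commute)
qed (auto simp: scaleC_vec_def cinner_vec_def vec_eq_iff scaleC_add_right scaleC_add_left
      scaleC_scaleC scaleC_of_real cinner_add_left cinner_scaleC_left sum.distrib
      sum_distrib_left Re_cinner inner_vec_def)
end

text \<open>
  For a scalar multiplication \<open>smul\<close> and an inner product \<open>ip\<close>, to be used with
  \<open>(*\<^sub>R)\<close> and \<open>(\<bullet>)\<close>, respectively \<open>(*\<^sub>C)\<close> and \<^const>\<open>cinner\<close>.
\<close>

definition orthonormal_basis ::
    "('k::field \<Rightarrow> 'a::ab_group_add \<Rightarrow> 'a) \<Rightarrow> ('a \<Rightarrow> 'a \<Rightarrow> 'k) \<Rightarrow> 'a set \<Rightarrow> bool"
  where "orthonormal_basis smul ip S \<longleftrightarrow>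
    \<not> module.dependent smul S \<and> module.span smul S = UNIV \<and>
    (\<forall>x\<in>S. ip x x = 1) \<and> (\<forall>x\<in>S. \<forall>y\<in>S. x \<noteq> y \<longrightarrow> ip x y = 0)"

definition preserves_orthogonality_on ::
    "('a \<Rightarrow> 'a \<Rightarrow> 'k::field) \<Rightarrow> ('a \<Rightarrow> 'a) \<Rightarrow> 'a set \<Rightarrow> bool"
  where "preserves_orthogonality_on ip T S \<longleftrightarrow>
    (\<forall>x\<in>S. \<forall>y\<in>S. x \<noteq> y \<longrightarrow> ip (T x) (T y) = 0)"

end

theory Submission
  imports Defs
begin

text \<open>
  A unit vector \<open>x\<close> maximising \<open>\<parallel>T x\<parallel>\<close> over the unit sphere of a subspace \<open>W\<close> satisfies
  \<open>\<langle>T x, T y\<rangle> = 0\<close> for all \<open>y \<in> W\<close> orthogonal to \<open>x\<close>: otherwise the maximum could be increased by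
  moving from \<open>x\<close> in the direction \<open>\<plusminus>y\<close>. Hence one chooses the basis vectors successively, each a
  maximiser on the orthogonal complement of the previous ones. The maximum exists by compactness
  of the unit sphere.
\<close>

section \<open>Perturbation of a norm maximiser\<close>

lemma linear_le_quadratic_imp_zero:
  fixes a b :: real
  assumes "\<And>t. t * a \<le> t\<^sup>2 * b"
  shows "a = 0"
proof (rule ccontr)
  assume "a \<noteq> 0"
  \<comment> \<open>The test value is \<open>t = a / c\<close>. The summand 1 makes \<open>c\<close>
    positive and strictly larger than \<open>b\<close> for every sign of \<open>b\<close>, so the
    hypothesis at this \<open>t\<close> reads \<open>a * a / c < a * a / c\<close>.\<close>
  define c where "c = \<bar>b\<bar> + 1"
  have c: "c > 0" "b < c"
    unfolding c_def by auto
  have "(a / c) * a \<le> (a / c)\<^sup>2 * b"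
    by (rule assms)
  also have "\<dots> < (a / c)\<^sup>2 * c"
    using c \<open>a \<noteq> 0\<close> by (intro mult_strict_left_mono) auto
  also have "\<dots> = (a / c) * a"
    using c by (simp add: power2_eq_square)
  finally show False
    by simp
qed

text \<open>By homogeneity \<open>norm (T x)\<close> bounds \<open>T\<close> on all of
  \<open>W\<close>. Squaring this bound at \<open>x + t *\<^sub>R y\<close>, the constant terms
  cancel because \<open>x\<close> is a unit vector, and the domain side has no linear term because
  \<open>x\<close> and \<open>y\<close> are orthogonal. What remains bounds a linear function of
  \<open>t\<close> by a quadratic one, for \<open>t\<close> of either sign.\<close>

lemma orthogonal_image_of_norm_maximizer:
  fixes T :: "'a::real_inner \<Rightarrow> 'b::real_inner"
  assumes T: "linear T" and W: "subspace W" and x: "x \<in> W" "norm x = 1"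
    and max: "\<And>z. z \<in> W \<Longrightarrow> norm z = 1 \<Longrightarrow> norm (T z) \<le> norm (T x)"
    and y: "y \<in> W" "x \<bullet> y = 0"
  shows "T x \<bullet> T y = 0"
proof -
  interpret T: linear T by (rule T)
  have bound: "norm (T z) \<le> norm (T x) * norm z" if "z \<in> W" for z
  proof (cases "z = 0")
    case False
    have "norm (T (z /\<^sub>R norm z)) \<le> norm (T x)"
      using False that by (intro max subspace_scale[OF W]) auto
    then show ?thesis
      using False by (simp add: T.scaleR field_simps)
  qed (simp add: T.zero)
  have "t * (2 * (T x \<bullet> T y)) \<le> t\<^sup>2 * ((norm (T x))\<^sup>2 * (norm y)\<^sup>2 - (norm (T y))\<^sup>2)" for t
  proof -
    have "(norm (T (x + t *\<^sub>R y)))\<^sup>2 \<le> (norm (T x) * norm (x + t *\<^sub>R y))\<^sup>2"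
      by (intro power_mono bound subspace_add[OF W] subspace_scale[OF W] x y) auto
    moreover have "(norm (T (x + t *\<^sub>R y)))\<^sup>2 =
        (norm (T x))\<^sup>2 + 2 * t * (T x \<bullet> T y) + t\<^sup>2 * (norm (T y))\<^sup>2"
      unfolding T.add T.scaleR power2_norm_eq_inner
      by (simp add: inner_add inner_commute power2_eq_square algebra_simps)
    moreover have "(norm (x + t *\<^sub>R y))\<^sup>2 = 1 + t\<^sup>2 * (norm y)\<^sup>2"
    proof -
      have "x \<bullet> x = 1"
        using x(2) by (simp add: norm_eq_1)
      then show ?thesis
        using y(2) unfolding power2_norm_eq_inner
        by (simp add: inner_add inner_commute power2_eq_square algebra_simps)
    qed
    ultimately show ?thesis
      by (simp add: power_mult_distrib algebra_simps)
  qed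
  then have "2 * (T x \<bullet> T y) = 0"
    by (rule linear_le_quadratic_imp_zero)
  then show ?thesis
    by simp
qed

text \<open>
  Treats \<open>\<real>\<close> and \<open>\<complex>\<close> simultaneously; \<open>ip_eq_0_iff\<close> reduces orthogonality over the scalar field to
  orthogonality for the underlying real inner product.
\<close>

locale finite_dimensional_ip_space = finite_dimensional_vector_space smul Basis
  for smul :: "'k::{real_normed_field, heine_borel} \<Rightarrow> 'a::real_inner \<Rightarrow> 'a" and Basis +
  fixes ip :: "'a \<Rightarrow> 'a \<Rightarrow> 'k"
  assumes smul_of_real: "smul (of_real r) x = r *\<^sub>R x"
    and norm_smul: "norm (smul c x) = norm c * norm x"
    and ip_add_left: "ip (x + y) z = ip x z + ip y z"
    and ip_smul_left: "ip (smul c x) z = c * ip x z"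
    and ip_self: "ip x x = of_real ((norm x)\<^sup>2)"
    and ip_eq_0_commute: "ip x y = 0 \<Longrightarrow> ip y x = 0"
    and ip_eq_0_iff: "ip x y = 0 \<longleftrightarrow> (\<forall>c. x \<bullet> smul c y = 0)"
    and norm_ip_le: "norm (ip x y) \<le> norm x * norm y"
begin

section \<open>Continuity of the operations in each scalar field\<close>

lemma bounded_linear_ip: "bounded_linear (\<lambda>x. ip x y)"
proof (rule bounded_linear_intro[where K = "norm y"])
  show "ip (r *\<^sub>R x) y = r *\<^sub>R ip x y" for r x
    by (metis smul_of_real ip_smul_left scaleR_conv_of_real)
qed (auto simp: ip_add_left norm_ip_le)

lemma bounded_linear_smul: "bounded_linear (\<lambda>c. smul c x)"
proof (rule bounded_linear_intro[where K = "norm x"])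
  show "smul (r *\<^sub>R c) x = r *\<^sub>R smul c x" for r c
    by (simp add: scaleR_conv_of_real flip: smul_of_real)
qed (auto simp: scale_left_distrib norm_smul)

lemmas ip_sum_left = linear_sum[OF bounded_linear.linear[OF bounded_linear_ip]]
lemmas ip_diff_left = linear_diff[OF bounded_linear.linear[OF bounded_linear_ip]]
lemmas ip_zero_left = linear_0[OF bounded_linear.linear[OF bounded_linear_ip]]

section \<open>Orthonormal sets and their orthogonal complements\<close>

definition orthonormal :: "'a set \<Rightarrow> bool" where
  "orthonormal S \<longleftrightarrow> (\<forall>x\<in>S. norm x = 1) \<and> (\<forall>x\<in>S. \<forall>y\<in>S. x \<noteq> y \<longrightarrow> ip x y = 0)"

definition orth_complement :: "'a set \<Rightarrow> 'a set" where
  "orth_complement S = {y. \<forall>s\<in>S. ip y s = 0}"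

lemma ip_orthonormal_sum:
  assumes "orthonormal S" "finite A" "A \<subseteq> S" "s \<in> A"
  shows "ip (\<Sum>x\<in>A. smul (c x) x) s = c s"
proof -
  have "ip (\<Sum>x\<in>A. smul (c x) x) s = (\<Sum>x\<in>A. c x * ip x s)"
    by (simp add: ip_sum_left ip_smul_left)
  also have "\<dots> = (\<Sum>x\<in>A. if x = s then c s else 0)"
    using assms by (intro sum.cong) (auto simp: orthonormal_def ip_self subset_iff)
  finally show ?thesis
    using assms by simp
qed

lemma orthonormal_independent:
  assumes "orthonormal S"
  shows "independent S"
  unfolding independent_explicit_module
proof (intro allI impI)
  fix A u v
  assume A: "finite A" "A \<subseteq> S" "(\<Sum>w\<in>A. smul (u w) w) = 0" "v \<in> A"
  show "u v = 0"
    using ip_orthonormal_sum[OF assms A(1,2,4), of u] A(3) by (simp add: ip_zero_left)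
qed

text \<open>The Gram-Schmidt remainder: the projection has the same coefficients against
  \<open>S\<close> as \<open>x\<close>, so they cancel.\<close>

lemma diff_projection_in_orth_complement:
  assumes "orthonormal S" "finite S"
  shows "x - (\<Sum>s\<in>S. smul (ip x s) s) \<in> orth_complement S"
  using ip_orthonormal_sum[OF assms(1,2) subset_refl]
  by (auto simp: orth_complement_def ip_diff_left)

lemma orthonormal_expansion:
  assumes "orthonormal S" "finite S" "orth_complement S \<subseteq> {0}"
  shows "x = (\<Sum>s\<in>S. smul (ip x s) s)"
  using diff_projection_in_orth_complement[OF assms(1,2), of x] assms(3) by auto

lemma orthonormal_basisI:
  assumes "orthonormal S" "finite S" "orth_complement S \<subseteq> {0}"
  shows "orthonormal_basis smul ip S"
proof -
  have "x \<in> span S" for x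
    by (subst orthonormal_expansion[OF assms, of x]) (intro span_sum span_scale span_base)
  then show ?thesis
    using assms(1) orthonormal_independent[OF assms(1)]
    by (auto simp: orthonormal_basis_def orthonormal_def ip_self)
qed

text \<open>Independence bounds the cardinality of orthonormal sets by the dimension, and a set of
  maximal cardinality with \<open>P\<close> admits no extension. Keeping \<open>P\<close> abstract
  lets one argument yield both some orthonormal basis and one adapted to an operator.\<close>

lemma ex_complete_orthonormal:
  assumes P: "\<And>S. P S \<Longrightarrow> orthonormal S" and "P {}"
    and extend: "\<And>S. P S \<Longrightarrow> finite S \<Longrightarrow> \<not> orth_complement S \<subseteq> {0} \<Longrightarrow> \<exists>x. x \<notin> S \<and> P (insert x S)"
  obtains S where "P S" "finite S" "orth_complement S \<subseteq> {0}"
proof -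
  have fin: "finite S" if "P S" for S
    using that by (intro finiteI_independent orthonormal_independent P)
  have "card S \<le> dim UNIV" if "P S" for S
    using that by (intro independent_card_le_dim orthonormal_independent P) auto
  \<comment> \<open>The library rule asks for a strict upper bound, hence
    \<open>Suc\<close>.\<close>
  then obtain S where S: "P S" "\<And>S'. P S' \<Longrightarrow> card S' \<le> card S"
    using ex_has_greatest_nat[of P "{}" card "Suc (dim UNIV)"] \<open>P {}\<close> le_imp_less_Suc by metis
  have "orth_complement S \<subseteq> {0}"
  proof (rule ccontr)
    assume "\<not> orth_complement S \<subseteq> {0}"
    then obtain x where "x \<notin> S" "P (insert x S)"
      using extend S(1) fin by blast
    with S(2) fin[OF S(1)] show False
      by fastforce
  qed
  with that S fin show thesis
    by blast
qed

lemma orthonormal_insert: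
  assumes "orthonormal S" "x \<in> orth_complement S" "norm x = 1"
  shows "orthonormal (insert x S)" "x \<notin> S"
proof -
  show "orthonormal (insert x S)"
    using assms by (auto simp: orthonormal_def orth_complement_def intro: ip_eq_0_commute)
  show "x \<notin> S"
    using assms by (auto simp: orth_complement_def ip_self)
qed

text \<open>Stated for real scalars because the maximiser argument runs in the underlying real
  space.\<close>

lemma subspace_orth_complement: "real_vector.subspace (orth_complement S)"
  by (auto simp: real_vector.subspace_def orth_complement_def ip_add_left ip_zero_left
      ip_smul_left simp flip: smul_of_real)

lemma smul_in_orth_complement: "x \<in> orth_complement S \<Longrightarrow> smul c x \<in> orth_complement S"
  by (auto simp: orth_complement_def ip_smul_left)

lemma closed_orth_complement: "closed (orth_complement S)"
proof -
  have "orth_complement S = (\<Inter>s\<in>S. {y. ip y s = 0})"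
    by (auto simp: orth_complement_def)
  then show ?thesis
    by (auto intro!: closed_INT closed_Collect_eq continuous_intros
        bounded_linear.continuous_on[OF bounded_linear_ip])
qed

lemma ex_unit_vector_orth_complement:
  assumes "\<not> orth_complement S \<subseteq> {0}"
  obtains x where "x \<in> orth_complement S" "norm x = 1"
proof -
  obtain y where "y \<in> orth_complement S" "y \<noteq> 0"
    using assms by auto
  then have "y /\<^sub>R norm y \<in> orth_complement S" "norm (y /\<^sub>R norm y) = 1"
    by (auto intro: real_vector.subspace_scale[OF subspace_orth_complement])
  with that show thesis
    by blast
qed

section \<open>Compactness of the unit sphere and continuity of linear maps\<close>

lemma ex_orthonormal_expansion:
  obtains E where "orthonormal E" "finite E" "\<forall>x. x = (\<Sum>e\<in>E. smul (ip x e) e)"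
proof -
  obtain E where "orthonormal E" "finite E" "orth_complement E \<subseteq> {0}"
  proof (rule ex_complete_orthonormal[of orthonormal])
    fix S assume "orthonormal S" "\<not> orth_complement S \<subseteq> {0}"
    then show "\<exists>x. x \<notin> S \<and> orthonormal (insert x S)"
      by (meson ex_unit_vector_orth_complement orthonormal_insert)
  qed (auto simp: orthonormal_def)
  then show thesis
    by (intro that allI orthonormal_expansion)
qed

text \<open>Each new vector of \<open>E\<close> contributes the image of the closed unit ball of
  scalars, compact by the Heine-Borel property of the field, and a sum of two compact sets is
  compact.\<close>

lemma compact_smul_sums:
  assumes "finite E"
  shows "compact {\<Sum>e\<in>E. smul (c e) e |c. \<forall>e\<in>E. norm (c e) \<le> 1}" (is "compact (?K E)")
  using assms
proof (induction E)
  case (insert a E)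
  have "?K (insert a E) = {u + v |u v. u \<in> (\<lambda>c. smul c a) ` cball 0 1 \<and> v \<in> ?K E}" (is "_ = ?R")
  proof (intro equalityI subsetI)
    fix z assume "z \<in> ?K (insert a E)"
    then obtain c where "z = (\<Sum>e\<in>insert a E. smul (c e) e)" "\<forall>e\<in>insert a E. norm (c e) \<le> 1"
      by auto
    then have "z = smul (c a) a + (\<Sum>e\<in>E. smul (c e) e)" "norm (c a) \<le> 1"
        "\<forall>e\<in>E. norm (c e) \<le> 1"
      using insert.hyps by auto
    moreover from this have "smul (c a) a \<in> (\<lambda>c. smul c a) ` cball 0 1"
      by (intro imageI) simp
    ultimately show "z \<in> ?R"
      by blast
  next
    fix z assume "z \<in> ?R"
    then obtain d c where z: "z = smul d a + (\<Sum>e\<in>E. smul (c e) e)" "norm d \<le> 1"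
        "\<forall>e\<in>E. norm (c e) \<le> 1"
      by auto
    \<comment> \<open>As \<open>a\<close> lies outside \<open>E\<close>, storing \<open>d\<close> at
      \<open>a\<close> leaves the old sum unchanged.\<close>
    have "(\<Sum>e\<in>E. smul ((c(a := d)) e) e) = (\<Sum>e\<in>E. smul (c e) e)"
      using insert.hyps by (intro sum.cong) auto
    then have "z = (\<Sum>e\<in>insert a E. smul ((c(a := d)) e) e)"
      using z insert.hyps by simp
    moreover have "\<forall>e\<in>insert a E. norm ((c(a := d)) e) \<le> 1"
      using z by auto
    ultimately show "z \<in> ?K (insert a E)"
      by blast
  qed
  moreover have "compact ((\<lambda>c. smul c a) ` cball 0 1)"
    by (intro compact_continuous_image compact_cball
        bounded_linear.continuous_on[OF bounded_linear_smul] continuous_intros)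
  ultimately show ?case
    using compact_sums[OF _ insert.IH] by (simp only:)
qed simp

text \<open>By Cauchy-Schwarz the coordinates of a unit vector in an orthonormal basis have norm at
  most 1, so the sphere is a closed subset of a compact set.\<close>

lemma compact_unit_sphere: "compact {x::'a. norm x = 1}"
proof -
  obtain E where E: "orthonormal E" "finite E" "\<forall>x. x = (\<Sum>e\<in>E. smul (ip x e) e)"
    by (rule ex_orthonormal_expansion)
  let ?K = "{\<Sum>e\<in>E. smul (c e) e |c. \<forall>e\<in>E. norm (c e) \<le> 1}"
  have "x \<in> ?K" if "norm x = 1" for x
  proof -
    have "\<forall>e\<in>E. norm (ip x e) \<le> 1"
      using E(1) that by (auto simp: orthonormal_def intro: order_trans[OF norm_ip_le])
    with spec[OF E(3), of x] show ?thesis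
      by blast
  qed
  then have "?K \<inter> {x. norm x = 1} = {x. norm x = 1}"
    by blast
  moreover have "compact (?K \<inter> {x. norm x = 1})"
    by (intro compact_Int_closed compact_smul_sums[OF E(2)] closed_Collect_eq continuous_intros)
  ultimately show ?thesis
    by (rule subst[where P = compact])
qed

text \<open>Expanding the argument in an orthonormal basis writes \<open>T\<close> as a finite sum
  of bounded coordinate functionals times fixed vectors.\<close>

lemma bounded_linear_if_linear:
  fixes T :: "'a \<Rightarrow> 'a"
  assumes "Vector_Spaces.linear smul smul T"
  shows "bounded_linear T"
proof -
  interpret T: Vector_Spaces.linear smul smul T by (rule assms)
  obtain E where "orthonormal E" "finite E" and E: "\<forall>x. x = (\<Sum>e\<in>E. smul (ip x e) e)"
    by (rule ex_orthonormal_expansion)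
  have "T x = (\<Sum>e\<in>E. smul (ip x e) (T e))" for x
    by (subst spec[OF E, of x]) (simp add: T.sum T.scale)
  then have "T = (\<lambda>x. \<Sum>e\<in>E. smul (ip x e) (T e))"
    by blast
  moreover have "bounded_linear (\<lambda>x. \<Sum>e\<in>E. smul (ip x e) (T e))"
    by (intro bounded_linear_sum bounded_linear_compose[OF bounded_linear_smul] bounded_linear_ip)
  ultimately show ?thesis
    by simp
qed

section \<open>Norm maximisers and construction of the basis\<close>

lemma ex_norm_maximizer_orth_complement:
  fixes T :: "'a \<Rightarrow> 'a"
  assumes T: "Vector_Spaces.linear smul smul T" and "\<not> orth_complement S \<subseteq> {0}"
  obtains x where "x \<in> orth_complement S" "norm x = 1"
    "\<And>y. y \<in> orth_complement S \<Longrightarrow> ip y x = 0 \<Longrightarrow> ip (T x) (T y) = 0"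
proof -
  interpret T: Vector_Spaces.linear smul smul T by (rule T)
  have bl: "bounded_linear T"
    by (rule bounded_linear_if_linear[OF T])
  let ?B = "orth_complement S \<inter> {x. norm x = 1}"
  have "compact ?B"
    by (intro closed_Int_compact closed_orth_complement compact_unit_sphere)
  moreover have "?B \<noteq> {}"
    using ex_unit_vector_orth_complement[OF assms(2)] by blast
  moreover have "continuous_on ?B (\<lambda>x. norm (T x))"
    by (intro continuous_intros bounded_linear.continuous_on[OF bl])
  ultimately obtain x where x: "x \<in> ?B" "\<forall>y\<in>?B. norm (T y) \<le> norm (T x)"
    using continuous_attains_sup by blast
  have "ip (T x) (T y) = 0" if y: "y \<in> orth_complement S" "ip y x = 0" for y
  proof -
    \<comment> \<open>The maximiser lemma only gives real orthogonality. Applying it to every scalar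
      multiple of \<open>y\<close> recovers orthogonality for \<open>ip\<close> through
      \<open>ip_eq_0_iff\<close>.\<close>
    have "T x \<bullet> T (smul c y) = 0" for c
    proof (rule orthogonal_image_of_norm_maximizer
          [where T = T and x = x and y = "smul c y", OF _ subspace_orth_complement[of S]])
      show "linear T"
        by (rule bounded_linear.linear[OF bl])
      show "x \<bullet> smul c y = 0"
        using ip_eq_0_commute[OF y(2)] ip_eq_0_iff by blast
    qed (use x y in \<open>auto intro: smul_in_orth_complement\<close>)
    then show ?thesis
      by (simp add: ip_eq_0_iff T.scale)
  qed
  with that x show thesis
    by blast
qed

theorem ex_orthonormal_basis_preserves_orthogonality:
  fixes T :: "'a \<Rightarrow> 'a"
  assumes T: "Vector_Spaces.linear smul smul T"
  obtains S where "finite S" "orthonormal_basis smul ip S" "preserves_orthogonality_on ip T S"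
proof -
  \<comment> \<open>The last conjunct is the invariant that keeps the construction going: any vector
    chosen later comes from the complement, so its image is already orthogonal to the images of the
    earlier ones.\<close>
  define P where "P S \<longleftrightarrow> orthonormal S \<and> preserves_orthogonality_on ip T S \<and>
    (\<forall>x\<in>S. \<forall>y\<in>orth_complement S. ip (T x) (T y) = 0)" for S
  obtain S where "P S" "finite S" "orth_complement S \<subseteq> {0}"
  proof (rule ex_complete_orthonormal[of P])
    fix S assume S: "P S" "\<not> orth_complement S \<subseteq> {0}"
    obtain x where x: "x \<in> orth_complement S" "norm x = 1"
      "\<And>y. y \<in> orth_complement S \<Longrightarrow> ip y x = 0 \<Longrightarrow> ip (T x) (T y) = 0"
      using ex_norm_maximizer_orth_complement[OF T S(2)] by metis
    have orth: "ip (T s) (T y) = 0" if "s \<in> S" "y \<in> orth_complement S" for s y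
      using S(1) that by (simp add: P_def)
    have "preserves_orthogonality_on ip T (insert x S)"
      using S(1) orth[OF _ x(1)] ip_eq_0_commute
      by (auto simp: P_def preserves_orthogonality_on_def)
    \<comment> \<open>The complement shrinks, so the invariant survives for old vectors; for
      \<open>x\<close> itself it is the maximiser property.\<close>
    moreover have "orth_complement (insert x S) = {y \<in> orth_complement S. ip y x = 0}"
      by (auto simp: orth_complement_def)
    ultimately have "P (insert x S)"
      using S(1) orth x(3) orthonormal_insert(1)[OF _ x(1,2)] by (auto simp: P_def)
    moreover have "x \<notin> S"
      using S(1) orthonormal_insert(2)[OF _ x(1,2)] by (simp add: P_def)
    ultimately show "\<exists>x. x \<notin> S \<and> P (insert x S)"
      by blast
  qed (auto simp: P_def orthonormal_def preserves_orthogonality_on_def)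
  then show thesis
    using that orthonormal_basisI by (auto simp: P_def)
qed

end

section \<open>The real and complex cases\<close>

lemma finite_dimensional_ip_space_real:
  assumes "finite_dimensional_vector_space ((*\<^sub>R) :: real \<Rightarrow> 'a::real_inner \<Rightarrow> 'a) B"
  shows "finite_dimensional_ip_space ((*\<^sub>R) :: real \<Rightarrow> 'a \<Rightarrow> 'a) B (\<bullet>)"
proof -
  interpret finite_dimensional_vector_space "(*\<^sub>R) :: real \<Rightarrow> 'a \<Rightarrow> 'a" B
    by (rule assms)
  show ?thesis
  proof unfold_locales
    fix x y :: 'a
    show "y \<bullet> x = 0" if "x \<bullet> y = 0"
      using that by (simp only: inner_commute[of y x])
    show "(x \<bullet> y = 0) = (\<forall>c. x \<bullet> c *\<^sub>R y = 0)"
      by (auto dest: spec[of _ 1])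
    show "norm (x \<bullet> y) \<le> norm x * norm y"
      by (simp add: Cauchy_Schwarz_ineq2)
  qed (simp_all add: inner_add_left power2_norm_eq_inner)
qed

lemma cinner_scaleC_right: "cinner x (c *\<^sub>C y) = cnj c * cinner x y"
  by (subst (1 2) cinner_commute) (simp add: cinner_scaleC_left)

text \<open>The norm stems from the real inner product, so complex homogeneity is read off from
  \<open>cinner_self\<close> by comparing squares.\<close>

lemma norm_scaleC: "norm (c *\<^sub>C x) = cmod c * norm x"
proof -
  have "complex_of_real ((norm (c *\<^sub>C x))\<^sup>2) = complex_of_real ((cmod c * norm x)\<^sup>2)"
    unfolding cinner_self[symmetric] cinner_scaleC_left cinner_scaleC_right
    by (simp add: cinner_self power_mult_distrib mult.commute[of "cnj c"]
        flip: mult.assoc complex_norm_square)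
  then show ?thesis
    by (metis of_real_eq_iff norm_ge_zero mult_nonneg_nonneg power2_eq_imp_eq)
qed

text \<open>Rotating \<open>x\<close> by a phase makes the inner product real, which reduces to the real inequality.\<close>

lemma norm_cinner_le: "cmod (cinner x y) \<le> norm x * norm y"
proof (cases "cinner x y = 0")
  case False
  define c where "c = cnj (sgn (cinner x y))"
  have "c * cinner x y = complex_of_real (cmod (cinner x y))"
    using False unfolding c_def
    by (simp add: sgn_eq field_simps power2_eq_square flip: complex_norm_square)
  then have "cmod (cinner x y) = (c *\<^sub>C x) \<bullet> y"
    by (metis Re_complex_of_real Re_cinner cinner_scaleC_left)
  also have "\<dots> \<le> norm (c *\<^sub>C x) * norm y"
    by (rule norm_cauchy_schwarz)
  also have "cmod c = 1"
    using False by (simp add: c_def norm_sgn)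
  then have "norm (c *\<^sub>C x) = norm x"
    by (simp add: norm_scaleC)
  finally show ?thesis .
qed simp

lemma finite_dimensional_ip_space_complex:
  assumes "finite_dimensional_vector_space ((*\<^sub>C) :: complex \<Rightarrow> 'a::complex_inner \<Rightarrow> 'a) B"
  shows "finite_dimensional_ip_space ((*\<^sub>C) :: complex \<Rightarrow> 'a \<Rightarrow> 'a) B cinner"
proof -
  interpret finite_dimensional_vector_space "(*\<^sub>C) :: complex \<Rightarrow> 'a \<Rightarrow> 'a" B
    by (rule assms)
  show ?thesis
  proof unfold_locales
    fix x y :: 'a
    show "cinner y x = 0" if "cinner x y = 0"
      using that cinner_commute[of y x] by simp
    have inner: "x \<bullet> c *\<^sub>C y = Re (cnj c * cinner x y)" for c
      by (simp only: cinner_scaleC_right flip: Re_cinner)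
    show "(cinner x y = 0) = (\<forall>c. x \<bullet> c *\<^sub>C y = 0)"
    proof
      assume "\<forall>c. x \<bullet> c *\<^sub>C y = 0"
      \<comment> \<open>The scalars 1 and the imaginary unit extract the real and the imaginary part
        of \<open>cinner x y\<close>.\<close>
      then have "Re (cnj 1 * cinner x y) = 0" "Re (cnj \<i> * cinner x y) = 0"
        unfolding inner by blast+
      then show "cinner x y = 0"
        by (simp add: complex_eq_iff)
    qed (simp add: inner)
  qed (simp_all add: scaleC_of_real norm_scaleC cinner_add_left cinner_scaleC_left cinner_self
      norm_cinner_le)
qed

theorem theorem2p2:
  fixes T :: "'a::{real_inner,complete_space} \<Rightarrow> 'a"
    and U :: "'b::{complex_inner,complete_space} \<Rightarrow> 'b"
  shows
    "((\<exists>B. finite_dimensional_vector_space ((*\<^sub>R) :: real \<Rightarrow> 'a \<Rightarrow> 'a) B) \<and>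
      Vector_Spaces.linear (*\<^sub>R) (*\<^sub>R) T \<longrightarrow>
      (\<exists>S. finite S \<and> orthonormal_basis (*\<^sub>R) (\<bullet>) S \<and>
           preserves_orthogonality_on (\<bullet>) T S)) \<and>
     ((\<exists>B. finite_dimensional_vector_space ((*\<^sub>C) :: complex \<Rightarrow> 'b \<Rightarrow> 'b) B) \<and>
      Vector_Spaces.linear (*\<^sub>C) (*\<^sub>C) U \<longrightarrow>
      (\<exists>S. finite S \<and> orthonormal_basis (*\<^sub>C) cinner S \<and>
           preserves_orthogonality_on cinner U S))"
proof (intro conjI impI; elim conjE exE)
  fix B
  assume "finite_dimensional_vector_space ((*\<^sub>R) :: real \<Rightarrow> 'a \<Rightarrow> 'a) B"
    and T: "Vector_Spaces.linear (*\<^sub>R) (*\<^sub>R) T"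
  then interpret finite_dimensional_ip_space "(*\<^sub>R) :: real \<Rightarrow> 'a \<Rightarrow> 'a" B "(\<bullet>)"
    by (intro finite_dimensional_ip_space_real)
  show "\<exists>S. finite S \<and> orthonormal_basis (*\<^sub>R) (\<bullet>) S \<and> preserves_orthogonality_on (\<bullet>) T S"
    by (rule ex_orthonormal_basis_preserves_orthogonality[OF T]) blast
next
  fix B
  assume "finite_dimensional_vector_space ((*\<^sub>C) :: complex \<Rightarrow> 'b \<Rightarrow> 'b) B"
    and U: "Vector_Spaces.linear (*\<^sub>C) (*\<^sub>C) U"
  then interpret finite_dimensional_ip_space "(*\<^sub>C) :: complex \<Rightarrow> 'b \<Rightarrow> 'b" B cinner
    by (intro finite_dimensional_ip_space_complex)
  show "\<exists>S. finite S \<and> orthonormal_basis (*\<^sub>C) cinner S \<and> preserves_orthogonality_on cinner U S"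
    by (rule ex_orthonormal_basis_preserves_orthogonality[OF U]) blast
qed

end
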